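(* There exists a sequence $\{\gamma_n\}_{n\ge1}$ in $\mathrm{Aut}(\mathbb{D})$ with $\gamma_n\to\mathrm{id}_{\mathbb{D}}$ such that the left iterated function system $L_n=\gamma_n\circ\gamma_{n-1}\circ\dots\circ\gamma_1$ generated by $\{\gamma_n\}$ is dense in $\mathrm{Aut}(\mathbb{D})$.
   Context: $\mathbb{D}$ is the open unit disc and $\mathrm{Aut}(\mathbb{D})$ is the group of conformal automorphisms of $\mathbb{D}$ with the compact-open topology (uniform convergence on compact subsets of $\mathbb{D}$); $\mathrm{id}_{\mathbb{D}}$ is the identity map. *)

theory Defs
  imports "HOL-Complex_Analysis.Complex_Analysis"
begin

abbreviation unit_disc :: "complex set"
  where "unit_disc \<equiv> ball 0 1"

text \<open>
  Functions on the disc are represented extensionally (value \<open>undefined\<close> off the disc), so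
  that equality in HOL is equality of maps of the disc; accordingly the identity is
  \<open>\<lambda>z\<in>unit_disc. z\<close> and composition is \<^const>\<open>compose\<close>.
\<close>

definition disc_Aut :: "(complex \<Rightarrow> complex) set"
  where "disc_Aut = {f \<in> extensional unit_disc.
    f holomorphic_on unit_disc \<and> bij_betw f unit_disc unit_disc}"

definition disc_id :: "complex \<Rightarrow> complex"
  where "disc_id = (\<lambda>z\<in>unit_disc. z)"

definition disc_Aut_topology :: "(complex \<Rightarrow> complex) topology"
  where "disc_Aut_topology = topology_generated_by
    {{f \<in> disc_Aut. f ` K \<subseteq> U} | K U. compact K \<and> K \<subseteq> unit_disc \<and> open U}"

text \<open>
  Sequences are indexed from 1; the values \<open>\<gamma> 0\<close> and \<open>left_ifs \<gamma> 0\<close> (the empty composition)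
  are not part of the system.
\<close>

primrec left_ifs :: "(nat \<Rightarrow> complex \<Rightarrow> complex) \<Rightarrow> nat \<Rightarrow> complex \<Rightarrow> complex"
  where
    "left_ifs \<gamma> 0 = disc_id"
  | "left_ifs \<gamma> (Suc n) = compose unit_disc (\<gamma> (Suc n)) (left_ifs \<gamma> n)"

lemma disc_id_in_disc_Aut: "disc_id \<in> disc_Aut"
proof -
  have "disc_id holomorphic_on unit_disc"
    by (rule holomorphic_transform[OF holomorphic_on_ident]) (simp add: disc_id_def)
  moreover have "bij_betw disc_id unit_disc unit_disc"
    by (subst bij_betw_cong[where g = "\<lambda>z. z"]) (auto simp: disc_id_def bij_betw_def)
  ultimately show ?thesis
    by (simp add: disc_Aut_def disc_id_def)
qed

lemma disc_Aut_imp_continuous_on: "f \<in> disc_Aut \<Longrightarrow> continuous_on unit_disc f"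
  by (simp add: disc_Aut_def holomorphic_on_imp_continuous_on)

lemma left_ifs_1: "\<gamma> 1 \<in> disc_Aut \<Longrightarrow> left_ifs \<gamma> 1 = \<gamma> 1"
  by (auto simp: fun_eq_iff compose_def disc_id_def disc_Aut_def extensional_def)

lemma topspace_disc_Aut_topology [simp]: "topspace disc_Aut_topology = disc_Aut"
proof -
  have "disc_Aut \<in> {{f \<in> disc_Aut. f ` K \<subseteq> U} | K U. compact K \<and> K \<subseteq> unit_disc \<and> open U}"
    by (intro CollectI exI[of _ "{}"]) auto
  then show ?thesis
    unfolding disc_Aut_topology_def topology_generated_by_topspace by blast
qed

text \<open>Convergence in the compact-open topology is locally uniform convergence.\<close>

lemma limitin_disc_Aut_topology_iff:
  assumes f: "\<forall>\<^sub>F n in F. f n \<in> disc_Aut"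
  shows "limitin disc_Aut_topology f g F \<longleftrightarrow>
    g \<in> disc_Aut \<and> (\<forall>K. compact K \<and> K \<subseteq> unit_disc \<longrightarrow> uniform_limit K f g F)"
proof (intro iffI conjI allI impI)
  assume L: "limitin disc_Aut_topology f g F"
  then show g: "g \<in> disc_Aut"
    by (simp add: limitin_def)
  fix K assume K: "compact K \<and> K \<subseteq> unit_disc"
  have cont: "continuous_on K g"
    using disc_Aut_imp_continuous_on[OF g] K continuous_on_subset by blast
  show "uniform_limit K f g F"
  proof (rule uniform_limitI)
    fix e :: real assume e: "0 < e"
    have "\<exists>r>0. \<forall>w\<in>K. dist w z \<le> r \<longrightarrow> dist (g w) (g z) < e / 2" if z: "z \<in> K" for z
    proof -
      obtain d where d: "d > 0" "\<forall>w\<in>K. dist w z < d \<longrightarrow> dist (g w) (g z) < e / 2"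
        using cont z half_gt_zero[OF e] unfolding continuous_on_iff by blast
      then show ?thesis by (intro exI[of _ "d/2"]) auto
    qed
    then obtain r where r: "\<And>z. z \<in> K \<Longrightarrow> r z > 0"
        "\<And>z w. \<lbrakk>z \<in> K; w \<in> K; dist w z \<le> r z\<rbrakk> \<Longrightarrow> dist (g w) (g z) < e / 2"
      by metis
    have "K \<subseteq> (\<Union>z\<in>K. ball z (r z))"
      using r(1) by force
    then obtain C where C: "C \<subseteq> K" "finite C" "K \<subseteq> (\<Union>z\<in>C. ball z (r z))"
      using K compactE_image[of K K "\<lambda>z. ball z (r z)"] by (metis open_ball)
    have "\<forall>\<^sub>F n in F. f n ` (K \<inter> cball z (r z)) \<subseteq> ball (g z) (e / 2)" if "z \<in> C" for z
    proof -
      let ?V = "{h \<in> disc_Aut. h ` (K \<inter> cball z (r z)) \<subseteq> ball (g z) (e / 2)}"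
      have "openin disc_Aut_topology ?V"
        unfolding disc_Aut_topology_def
        by (rule topology_generated_by_Basis) (use K in blast)
      moreover have "g \<in> ?V"
        using g r(2)[of z] that C(1)
        by (force simp: image_subset_iff dist_commute[of z] dist_commute[of "g z"])
      ultimately have "\<forall>\<^sub>F n in F. f n \<in> ?V"
        using L unfolding limitin_def by blast
      then show ?thesis by (rule eventually_mono) auto
    qed
    then have "\<forall>\<^sub>F n in F. \<forall>z\<in>C. f n ` (K \<inter> cball z (r z)) \<subseteq> ball (g z) (e / 2)"
      using C(2) by (simp add: eventually_ball_finite)
    then show "\<forall>\<^sub>F n in F. \<forall>x\<in>K. dist (f n x) (g x) < e"
    proof (rule eventually_mono, intro ballI)
      fix n x
      assume *: "\<forall>z\<in>C. f n ` (K \<inter> cball z (r z)) \<subseteq> ball (g z) (e / 2)" and x: "x \<in> K"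
      obtain z where z: "z \<in> C" "dist z x < r z"
        using C(3) x by auto
      have "dist (g z) (f n x) < e / 2"
        using * z x by (force simp: image_subset_iff)
      moreover have "dist (g x) (g z) < e / 2"
        using r(2)[of z x] z x C(1) by (force simp: dist_commute[of x z])
      ultimately show "dist (f n x) (g x) < e"
        by (metis dist_commute dist_triangle_half_l)
    qed
  qed
next
  assume R: "g \<in> disc_Aut \<and> (\<forall>K. compact K \<and> K \<subseteq> unit_disc \<longrightarrow> uniform_limit K f g F)"
  have "\<forall>\<^sub>F n in F. f n \<in> W" if "openin disc_Aut_topology W" "g \<in> W" for W
  proof -
    have "generate_topology_on
        {{f \<in> disc_Aut. f ` K \<subseteq> U} | K U. compact K \<and> K \<subseteq> unit_disc \<and> open U} W"
      using that(1) unfolding disc_Aut_topology_def by (rule openin_topology_generated_by)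
    then show ?thesis
      using that(2)
    proof induction
      case Empty
      then show ?case by simp
    next
      case (Int a b)
      then show ?case by (simp add: eventually_conj_iff)
    next
      case (UN \<K>)
      then obtain k where "k \<in> \<K>" "g \<in> k" "\<forall>\<^sub>F n in F. f n \<in> k" by blast
      then show ?case by (auto elim: eventually_mono)
    next
      case (Basis s)
      then obtain K U where s: "s = {f \<in> disc_Aut. f ` K \<subseteq> U}"
        and K: "compact K" "K \<subseteq> unit_disc" and U: "open U" and gK: "g ` K \<subseteq> U"
        by blast
      have "continuous_on K g"
        using disc_Aut_imp_continuous_on[of g] R K(2) continuous_on_subset by blast
      then have "compact (g ` K)"
        using K(1) by (rule compact_continuous_image)
      then obtain e where e: "e > 0" "(\<Union>y\<in>g ` K. ball y e) \<subseteq> U"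
        using compact_subset_open_imp_ball_epsilon_subset[OF _ U gK] by blast
      have "\<forall>\<^sub>F n in F. \<forall>x\<in>K. dist (f n x) (g x) < e"
        using R K e(1) by (simp add: uniform_limit_iff)
      then show ?case
        using f
      proof eventually_elim
        case (elim n)
        then have "f n x \<in> U" if "x \<in> K" for x
          using that e(2) by (force simp: dist_commute)
        then show ?case
          using elim s by blast
      qed
    qed
  qed
  then show "limitin disc_Aut_topology f g F"
    using R by (simp add: limitin_def)
qed

end

theory Submission
  imports Defs
begin

text \<open>
  The group of automorphisms of the disc is connected and separable, and its topology is induced
  by a metric that is invariant under right translation, namely the supremum of \<open>|f z - g z|\<close>
  over the whole disc: precomposing \<open>f\<close> and \<open>g\<close> with an
  automorphism only permutes the points \<open>z\<close>. Hence for a sequence \<open>p\<close> of automorphisms starting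
  at the identity, the quotients \<open>\<gamma> n = p n \<circ> (p (n - 1))\<inverse>\<close> tend to the identity as
  soon as the distance from \<open>p (n - 1)\<close> to \<open>p n\<close> tends to \<open>0\<close>, and the left iterated
  function system generated by \<open>\<gamma>\<close> telescopes to \<open>p\<close> itself. What has to be found is
  therefore a dense sequence of automorphisms whose consecutive distances tend to \<open>0\<close>.

  In a connected metric space any two points are joined, for every \<open>\<epsilon> > 0\<close>, by a finite chain
  with steps shorter than \<open>\<epsilon>\<close>. Starting from a dense sequence \<open>q\<close>, one walks from \<open>q k\<close> to
  \<open>q (k + 1)\<close> along a chain with steps shorter than \<open>1 / (k + 1)\<close>, one chain after the other
  (\<open>concatenated_walk\<close>).

  Connectedness and separability come from a parametrization. By the Schwarz lemma every
  automorphism is a rotation after a Moebius map \<open>z \<mapsto> (z - w) / (1 - cnj w * z)\<close>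
  (\<open>disc_Aut_eq_moebius\<close>), so the group is the image of \<open>\<real> \<times> unit_disc\<close>, and an explicit
  local Lipschitz estimate shows that the parametrization is continuous for the supremum distance
  (\<open>disc_moebius_unif_continuous\<close>).
\<close>

section \<open>Concatenating chains\<close>

text \<open>
  The relation \<open>R k\<close> stands for being at distance less than a bound that shrinks with \<open>k\<close>, and
  \<open>T k\<close> is the time at which the walk reaches \<open>q k\<close>. Transitive closure without reflexivity makes
  every chain contain at least one step, so that \<open>T\<close> is strictly increasing even where \<open>q\<close>
  repeats a value.
\<close>

lemma concatenated_walk:
  fixes R :: "nat \<Rightarrow> 'a \<Rightarrow> 'a \<Rightarrow> bool" and q :: "nat \<Rightarrow> 'a"
  assumes antimono: "\<And>k l x y. \<lbrakk>k \<le> l; R l x y\<rbrakk> \<Longrightarrow> R k x y"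
    and link: "\<And>k. (R k)\<^sup>+\<^sup>+ (q k) (q (Suc k))"
  obtains p :: "nat \<Rightarrow> 'a" and T :: "nat \<Rightarrow> nat"
  where "strict_mono T" "T 0 = 0" "\<And>k. p (T k) = q k"
    and "\<And>k n. T k \<le> n \<Longrightarrow> R k (p n) (p (Suc n))"
proof -
  have "\<forall>k. \<exists>N f. N > 0 \<and> f 0 = q k \<and> f N = q (Suc k) \<and> (\<forall>i<N. R k (f i) (f (Suc i)))"
    using link unfolding tranclp_power relpowp_fun_conv by metis
  then obtain N f where N: "\<And>k. N k > (0::nat)" and f0: "\<And>k. f k 0 = q k"
    and fN: "\<And>k. f k (N k) = q (Suc k)"
    and fR: "\<And>k i. i < N k \<Longrightarrow> R k (f k i) (f k (Suc i))"
    by metis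
  define T where "T k = sum N {..<k}" for k
  have T_Suc: "T (Suc k) = T k + N k" for k
    by (simp add: T_def)
  have T: "strict_mono T"
    by (simp add: strict_mono_Suc_iff T_Suc N)
  \<comment> \<open>The index of the chain that the walk is on at time \<open>n\<close>; at a time \<open>T k\<close>, where two
    chains meet, it is the later of the two.\<close>
  define K where "K n = (LEAST k. n < T (Suc k))" for n
  have K: "K n = k" if "T k \<le> n" "n < T (Suc k)" for n k
    unfolding K_def
  proof (rule Least_equality)
    show "n < T (Suc k)" by fact
    fix l assume "n < T (Suc l)"
    then have "T k < T (Suc l)" using that by linarith
    then show "k \<le> l" using T by (simp add: strict_mono_less)
  qed
  have block: "\<exists>k i. n = T k + i \<and> i < N k" for n
  proof (induction n)
    case 0
    then show ?case using N[of 0] by (intro exI[of _ 0]) (simp add: T_def)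
  next
    case (Suc n)
    then obtain k i where n: "n = T k + i" "i < N k" by blast
    show ?case
    proof (cases "Suc i < N k")
      case True
      then show ?thesis using n by (intro exI[of _ k] exI[of _ "Suc i"]) auto
    next
      case False
      then show ?thesis
        using n N by (intro exI[of _ "Suc k"] exI[of _ 0]) (auto simp: T_Suc)
    qed
  qed
  define p where "p n = f (K n) (n - T (K n))" for n
  have p_lt: "p (T k + i) = f k i" if "i < N k" for k i
    using K[of k "T k + i"] that by (simp add: p_def T_Suc)
  have p_T: "p (T k) = q k" for k
    using p_lt[of 0 k] N f0 by simp
  have p_le: "p (T k + i) = f k i" if "i \<le> N k" for k i
    using that p_lt[of i k] p_T[of "Suc k"] fN[of k]
    by (cases "i < N k") (auto simp: T_Suc)
  show thesis
  proof
    show "strict_mono T" "T 0 = 0" "\<And>k. p (T k) = q k"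
      using T p_T by (auto simp: T_def)
    fix k n assume "T k \<le> n"
    obtain l i where n: "n = T l + i" "i < N l"
      using block by blast
    have "T k < T (Suc l)"
      using n \<open>T k \<le> n\<close> by (simp add: T_Suc)
    then have "k \<le> l"
      using T by (simp add: strict_mono_less)
    moreover have "R l (p n) (p (Suc n))"
      using fR[of i l] p_le[of i l] p_le[of "Suc i" l] n by simp
    ultimately show "R k (p n) (p (Suc n))"
      by (rule antimono)
  qed
qed

section \<open>Continuity of Moebius maps in their parameters\<close>

lemma norm_one_minus_cnj_mult_ge:
  fixes w z :: complex
  assumes "norm z < 1"
  shows "1 - norm w \<le> norm (1 - cnj w * z)"
proof -
  have "norm w * norm z \<le> norm w"
    using assms by (simp add: mult_left_le)
  moreover have "1 - norm (cnj w * z) \<le> norm (1 - cnj w * z)"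
    by (metis norm_one norm_triangle_ineq2)
  ultimately show ?thesis
    by (simp add: norm_mult)
qed

text \<open>
  Over the common denominator, the numerator of the difference is a polynomial in \<open>z\<close> of degree
  two whose three coefficients vanish for \<open>v = w\<close>; they are at most \<open>dist v w\<close>,
  \<open>2 * dist v w\<close> and \<open>dist v w\<close>, which gives the constant \<open>4\<close>. The bound does not depend on
  \<open>z\<close>, hence it controls the supremum distance on the whole open disc.
\<close>
lemma dist_Moebius_function_0_le:
  assumes v: "norm v < 1" and w: "norm w < 1" and z: "norm z < 1"
  shows "dist (Moebius_function 0 v z) (Moebius_function 0 w z)
      \<le> 4 * dist v w / ((1 - norm v) * (1 - norm w))"
proof -
  let ?A = "1 - cnj v * z" and ?B = "1 - cnj w * z"
  have A: "1 - norm v \<le> norm ?A" and B: "1 - norm w \<le> norm ?B"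
    using norm_one_minus_cnj_mult_ge z by auto
  then have ne: "?A \<noteq> 0" "?B \<noteq> 0"
    using v w by auto
  define d where "d = v - w"
  have "Moebius_function 0 v z - Moebius_function 0 w z
      = ((z - v) * ?B - (z - w) * ?A) / (?A * ?B)"
    using ne by (simp add: Moebius_function_simple diff_frac_eq)
  also have "(z - v) * ?B - (z - w) * ?A
      = - d + cnj d * z * z + (v * (- cnj d) + d * cnj v) * z"
    by (simp add: d_def algebra_simps)
  finally have eq: "Moebius_function 0 v z - Moebius_function 0 w z
      = (- d + cnj d * z * z + (v * (- cnj d) + d * cnj v) * z) / (?A * ?B)" .
  have le: "norm (x * y) \<le> norm x" if "norm y < 1" for x y :: complex
    using that by (simp add: norm_mult mult_left_le)
  have "norm (cnj d * z * z) \<le> norm d"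
    using le[OF z, of "cnj d * z"] le[OF z, of "cnj d"] by simp
  moreover have "norm ((v * (- cnj d) + d * cnj v) * z) \<le> norm d + norm d"
    using le[OF z, of "v * (- cnj d) + d * cnj v"] norm_triangle_ineq[of "v * (- cnj d)" "d * cnj v"]
      le[of v "- cnj d"] le[of "cnj v" d] v by (simp add: mult.commute)
  ultimately have num: "norm (- d + cnj d * z * z + (v * (- cnj d) + d * cnj v) * z) \<le> 4 * norm d"
    using norm_triangle_ineq[of "- d + cnj d * z * z" "(v * (- cnj d) + d * cnj v) * z"]
      norm_triangle_ineq[of "- d" "cnj d * z * z"] by simp
  show ?thesis
    unfolding dist_norm eq norm_divide
    using num A B v w unfolding norm_mult[of ?A] d_def
    by (intro frac_le mult_mono mult_pos_pos) auto
qed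

lemma dist_Moebius_function_le:
  assumes v: "norm v < 1" and w: "norm w < 1" and z: "norm z < 1"
  shows "dist (Moebius_function s v z) (Moebius_function t w z)
      \<le> dist (exp (\<i> * of_real s)) (exp (\<i> * of_real t))
        + 4 * dist v w / ((1 - norm v) * (1 - norm w))"
proof -
  let ?a = "exp (\<i> * of_real s)" and ?b = "exp (\<i> * of_real t)"
  let ?x = "Moebius_function 0 v z" and ?y = "Moebius_function 0 w z"
  have "Moebius_function s v z - Moebius_function t w z = (?a - ?b) * ?x + ?b * (?x - ?y)"
    by (simp add: Moebius_function_def algebra_simps diff_divide_distrib)
  then have "dist (Moebius_function s v z) (Moebius_function t w z)
      \<le> norm (?a - ?b) * norm ?x + norm (?x - ?y)"
    unfolding dist_norm by (metis norm_triangle_ineq norm_mult norm_exp_i_times mult_1)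
  also have "norm (?a - ?b) * norm ?x \<le> norm (?a - ?b)"
    using Moebius_function_norm_lt_1[OF v z, of 0] by (simp add: mult_left_le)
  finally show ?thesis
    using dist_Moebius_function_0_le[OF v w z] by (simp add: dist_norm)
qed


section \<open>The automorphism group and its parametrization\<close>

lemma disc_AutI:
  assumes "f \<in> extensional unit_disc" "f holomorphic_on unit_disc"
    and "f ` unit_disc \<subseteq> unit_disc" "g ` unit_disc \<subseteq> unit_disc"
    and "\<And>z. z \<in> unit_disc \<Longrightarrow> g (f z) = z" "\<And>z. z \<in> unit_disc \<Longrightarrow> f (g z) = z"
  shows "f \<in> disc_Aut"
proof -
  have "bij_betw f unit_disc unit_disc"
    by (rule bij_betw_byWitness[where f' = g]) (use assms in blast)+
  then show ?thesis
    using assms(1,2) by (simp add: disc_Aut_def)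
qed

lemma disc_Aut_compose:
  assumes f: "f \<in> disc_Aut" and g: "g \<in> disc_Aut"
  shows "compose unit_disc f g \<in> disc_Aut"
proof -
  have "f \<circ> g holomorphic_on unit_disc"
    using assms by (intro holomorphic_on_compose_gen[of _ _ _ unit_disc])
      (auto simp: disc_Aut_def bij_betw_def)
  then have "compose unit_disc f g holomorphic_on unit_disc"
    by (rule holomorphic_transform) (simp add: compose_def)
  then show ?thesis
    using assms bij_betw_compose[of g unit_disc unit_disc f unit_disc]
    by (simp add: disc_Aut_def)
qed

definition disc_inv :: "(complex \<Rightarrow> complex) \<Rightarrow> complex \<Rightarrow> complex"
  where "disc_inv f = restrict (inv_into unit_disc f) unit_disc"

lemma disc_inv_f:
  assumes "f \<in> disc_Aut" "z \<in> unit_disc"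
  shows "f z \<in> unit_disc" "disc_inv f (f z) = z"
  using assms unfolding disc_Aut_def disc_inv_def
  by (auto simp: bij_betw_def)

lemma f_disc_inv:
  assumes "f \<in> disc_Aut" "z \<in> unit_disc"
  shows "disc_inv f z \<in> unit_disc" "f (disc_inv f z) = z"
proof -
  have "z \<in> f ` unit_disc"
    using assms by (simp add: disc_Aut_def bij_betw_def)
  then show "disc_inv f z \<in> unit_disc" "f (disc_inv f z) = z"
    using assms(2) inv_into_into[of z f unit_disc] f_inv_into_f[of z f unit_disc]
    by (auto simp: disc_inv_def)
qed

lemma disc_inv_in_disc_Aut:
  assumes f: "f \<in> disc_Aut"
  shows "disc_inv f \<in> disc_Aut"
proof (rule disc_AutI)
  have hol: "f holomorphic_on unit_disc"
    and im: "f ` unit_disc = unit_disc" and inj: "inj_on f unit_disc"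
    using f by (auto simp: disc_Aut_def bij_betw_def)
  obtain g where g: "g holomorphic_on f ` unit_disc" "\<And>z. z \<in> unit_disc \<Longrightarrow> g (f z) = z"
    using holomorphic_has_inverse[OF hol open_ball inj] by metis
  show "disc_inv f holomorphic_on unit_disc"
  proof (rule holomorphic_transform)
    show "g holomorphic_on unit_disc"
      using g(1) im by simp
    show "g z = disc_inv f z" if "z \<in> unit_disc" for z
      using g(2)[of "disc_inv f z"] f_disc_inv[OF f that] by simp
  qed
  show "disc_inv f \<in> extensional unit_disc"
    by (simp add: disc_inv_def)
  show "disc_inv f ` unit_disc \<subseteq> unit_disc" "f ` unit_disc \<subseteq> unit_disc"
    using f_disc_inv(1)[OF f] im by blast+
  show "f (disc_inv f z) = z" "disc_inv f (f z) = z" if "z \<in> unit_disc" for z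
    using f_disc_inv[OF f that] disc_inv_f[OF f that] by blast+
qed

definition disc_moebius :: "real \<times> complex \<Rightarrow> complex \<Rightarrow> complex"
  where "disc_moebius = (\<lambda>(t, w). restrict (Moebius_function t w) unit_disc)"

text \<open>
  The angle ranges over all of \<open>\<real>\<close> instead of a circle: the parametrization need not be
  injective, and the parameter space is then visibly connected.
\<close>
definition moebius_params :: "(real \<times> complex) set"
  where "moebius_params = UNIV \<times> unit_disc"

lemma disc_moebius_in_disc_Aut:
  assumes "p \<in> moebius_params"
  shows "disc_moebius p \<in> disc_Aut"
proof -
  obtain t w where p: "p = (t, w)" by fastforce
  then have w: "norm w < 1"
    using assms by (simp add: moebius_params_def)
  define u where "u = exp (\<i> * of_real t)"
  have u: "norm u = 1" "u \<noteq> 0"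
    by (simp_all add: u_def)
  have rotate: "disc_moebius p z = u * Moebius_function 0 w z" if "z \<in> unit_disc" for z
    using that by (simp add: p disc_moebius_def u_def Moebius_function_def)
  let ?g = "\<lambda>z. Moebius_function 0 (- w) (z / u)"
  show ?thesis
  proof (rule disc_AutI[where g = ?g])
    show "disc_moebius p \<in> extensional unit_disc"
      by (simp add: p disc_moebius_def)
    show "disc_moebius p holomorphic_on unit_disc"
      by (rule holomorphic_transform[OF Moebius_function_holomorphic[OF w, of t]])
        (simp add: p disc_moebius_def)
    show "disc_moebius p ` unit_disc \<subseteq> unit_disc"
      using Moebius_function_norm_lt_1[OF w] by (auto simp: p disc_moebius_def)
    show g: "?g ` unit_disc \<subseteq> unit_disc"
      using w u by (auto intro!: Moebius_function_norm_lt_1 simp: norm_divide)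
    show "?g (disc_moebius p z) = z" if "z \<in> unit_disc" for z
      using that w u Moebius_function_compose[of "- w" w z] by (simp add: rotate)
    show "disc_moebius p (?g z) = z" if z: "z \<in> unit_disc" for z
    proof -
      have "?g z \<in> unit_disc" using g z by blast
      then show ?thesis
        using z w u Moebius_function_compose[of w "- w" "z / u"]
        by (simp add: rotate norm_divide)
    qed
  qed
qed

text \<open>
  If \<open>f a = 0\<close>, then \<open>f\<close> composed with the inverse of the Moebius map that takes \<open>a\<close> to \<open>0\<close> is an
  automorphism \<open>h\<close> fixing \<open>0\<close>. The Schwarz lemma for \<open>h\<close> and for its inverse gives
  \<open>|h z| = |z|\<close>, and its case of equality says that \<open>h\<close> is a rotation.
\<close>
lemma disc_Aut_eq_moebius: "disc_Aut = disc_moebius ` moebius_params"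
proof
  show "disc_moebius ` moebius_params \<subseteq> disc_Aut"
    using disc_moebius_in_disc_Aut by blast
  show "disc_Aut \<subseteq> disc_moebius ` moebius_params"
  proof
    fix f assume f: "f \<in> disc_Aut"
    define a where "a = disc_inv f 0"
    have a: "norm a < 1" "f a = 0"
      using f_disc_inv[OF f, of 0] by (auto simp: a_def)
    define h where "h = compose unit_disc f (disc_moebius (0, - a))"
    have h: "h \<in> disc_Aut"
      unfolding h_def using f a
      by (intro disc_Aut_compose disc_moebius_in_disc_Aut) (auto simp: moebius_params_def)
    have h0: "h 0 = 0"
      using a by (simp add: h_def compose_def disc_moebius_def Moebius_function_of_zero)
    define k where "k = disc_inv h"
    have k: "k \<in> disc_Aut"
      unfolding k_def using h by (rule disc_inv_in_disc_Aut)
    have k0: "k 0 = 0"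
      using disc_inv_f[OF h, of 0] h0 by (simp add: k_def)
    have hol: "h holomorphic_on unit_disc" "k holomorphic_on unit_disc"
      using h k by (simp_all add: disc_Aut_def)
    have in_disc: "norm (h z) < 1" "norm (k z) < 1" if "norm z < 1" for z
      using disc_inv_f(1)[OF h] disc_inv_f(1)[OF k] that by auto
    have "norm (h z) \<le> norm z" "norm (k z) \<le> norm z" if "norm z < 1" for z
      using Schwarz_Lemma(1)[OF hol(1) h0 in_disc(1) that]
        Schwarz_Lemma(1)[OF hol(2) k0 in_disc(2) that] by auto
    then have "norm (h z) = norm z" if "norm z < 1" for z
      using that disc_inv_f(2)[OF h, of z] in_disc(1)[OF that]
      by (metis k_def mem_ball_0 order_antisym)
    then have "\<exists>z. norm z < 1 \<and> z \<noteq> 0 \<and> norm (h z) = norm z"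
      by (intro exI[of _ "1/2"]) auto
    then obtain \<alpha> where \<alpha>: "\<And>z. norm z < 1 \<Longrightarrow> h z = \<alpha> * z" "norm \<alpha> = 1"
      using Schwarz_Lemma(3)[OF hol(1) h0 in_disc(1), of 0] by auto
    then obtain t where t: "\<alpha> = exp (\<i> * of_real t)"
      by (metis complex_norm_eq_1_exp)
    have "f z = disc_moebius (t, a) z" for z
    proof (cases "norm z < 1")
      case True
      let ?u = "Moebius_function 0 a z"
      have u: "norm ?u < 1"
        using a(1) True by (rule Moebius_function_norm_lt_1)
      have "f z = h ?u"
        using Moebius_function_compose[of "- a" a z] a True u
        by (simp add: h_def compose_def disc_moebius_def)
      also have "\<dots> = Moebius_function t a z"
        using \<alpha>(1)[OF u] by (simp add: t Moebius_function_def)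
      finally show ?thesis
        using True by (simp add: disc_moebius_def)
    next
      case False
      then show ?thesis
        using f by (simp add: disc_moebius_def disc_Aut_def extensional_def)
    qed
    then have "f = disc_moebius (t, a)"
      by blast
    then show "f \<in> disc_moebius ` moebius_params"
      using a(1) by (auto simp: moebius_params_def)
  qed
qed

section \<open>The supremum distance on the automorphism group\<close>

text \<open>
  Closeness is measured on the whole disc rather than on compact subsets. For automorphisms this
  yields the same topology, because the parameters of a Moebius map (the angle taken modulo
  \<open>2 * pi\<close>) depend continuously on its restriction to a small compact set, and it is what makes the
  distance invariant under right translation.
\<close>
definition unif_near :: "real \<Rightarrow> (complex \<Rightarrow> complex) \<Rightarrow> (complex \<Rightarrow> complex) \<Rightarrow> bool"
  where "unif_near e f g \<longleftrightarrow> (\<forall>z\<in>unit_disc. dist (f z) (g z) < e)"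

lemma unif_near_sym: "unif_near e f g \<Longrightarrow> unif_near e g f"
  by (simp add: unif_near_def dist_commute)

lemma unif_near_mono: "unif_near d f g \<Longrightarrow> d \<le> e \<Longrightarrow> unif_near e f g"
  by (auto simp: unif_near_def intro: less_le_trans)

lemma unif_near_right_translate:
  assumes "unif_near e f g" "h \<in> disc_Aut"
  shows "unif_near e (compose unit_disc f h) (compose unit_disc g h)"
  using assms disc_inv_f(1)[OF assms(2)] by (simp add: unif_near_def compose_def)

lemma disc_moebius_unif_continuous:
  assumes p: "p \<in> moebius_params" and e: "e > 0"
  obtains U where "open U" "p \<in> U"
    and "\<And>q. \<lbrakk>q \<in> U; q \<in> moebius_params\<rbrakk> \<Longrightarrow> unif_near e (disc_moebius p) (disc_moebius q)"
proof -
  obtain s v where pv: "p = (s, v)" by fastforce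
  then have v: "norm v < 1"
    using p by (simp add: moebius_params_def)
  define B where "B q = dist (exp (\<i> * of_real s)) (exp (\<i> * of_real (fst q)))
      + 4 * dist v (snd q) / ((1 - norm v) * (1 - norm (snd q)))" for q :: "real \<times> complex"
  have "continuous (at p) B"
    unfolding B_def using v by (intro continuous_intros) (auto simp: pv)
  then have "(B \<longlongrightarrow> B p) (nhds p)"
    by (simp add: isCont_def tendsto_at_iff_tendsto_nhds)
  moreover have "B p < e"
    using e by (simp add: B_def pv)
  ultimately have "\<forall>\<^sub>F q in nhds p. B q < e"
    by (rule order_tendstoD)
  then obtain U where U: "open U" "p \<in> U" "\<And>q. q \<in> U \<Longrightarrow> B q < e"
    unfolding eventually_nhds by blast
  have "unif_near e (disc_moebius p) (disc_moebius q)" if "q \<in> U" "q \<in> moebius_params" for q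
  proof -
    have "norm (snd q) < 1"
      using that(2) by (auto simp: moebius_params_def)
    then have "dist (Moebius_function s v z) (Moebius_function (fst q) (snd q) z) \<le> B q"
      if "norm z < 1" for z
      unfolding B_def using dist_Moebius_function_le[OF v _ that] by blast
    then show ?thesis
      using U(3)[OF that(1)] by (force simp: unif_near_def disc_moebius_def pv split_beta)
  qed
  with U(1,2) show thesis
    by (rule that)
qed

text \<open>
  Being linked by a finite chain of steps shorter than \<open>e\<close> is an equivalence relation, and by
  continuity of the parametrization its classes are open in the connected parameter space.
\<close>
lemma disc_Aut_linked:
  assumes f: "f \<in> disc_Aut" and g: "g \<in> disc_Aut" and e: "e > 0"
  shows "(\<lambda>f g. f \<in> disc_Aut \<and> g \<in> disc_Aut \<and> unif_near e f g)\<^sup>+\<^sup>+ f g"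
proof -
  define N where "N = (\<lambda>f g. f \<in> disc_Aut \<and> g \<in> disc_Aut \<and> unif_near e f g)"
  obtain p q where p: "p \<in> moebius_params" "f = disc_moebius p"
    and q: "q \<in> moebius_params" "g = disc_moebius q"
    using f g by (auto simp: disc_Aut_eq_moebius)
  have "connected moebius_params"
    by (simp add: moebius_params_def connected_Times)
  then have "N\<^sup>+\<^sup>+ (disc_moebius p) (disc_moebius q)"
    using p(1) q(1)
  proof (rule connected_equivalence_relation)
    have "symp N"
      by (intro sympI) (simp add: N_def unif_near_sym)
    then have sym: "symp N\<^sup>+\<^sup>+"
      by (rule sym_trancl[to_pred])
    show "N\<^sup>+\<^sup>+ (disc_moebius y) (disc_moebius x)"
      if "N\<^sup>+\<^sup>+ (disc_moebius x) (disc_moebius y)" for x y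
      using sym that by (metis sympD)
    show "N\<^sup>+\<^sup>+ (disc_moebius x) (disc_moebius z)"
      if "N\<^sup>+\<^sup>+ (disc_moebius x) (disc_moebius y)" "N\<^sup>+\<^sup>+ (disc_moebius y) (disc_moebius z)" for x y z
      using that by (rule tranclp_trans)
    fix a assume a: "a \<in> moebius_params"
    obtain U where U: "open U" "a \<in> U"
      "\<And>x. \<lbrakk>x \<in> U; x \<in> moebius_params\<rbrakk> \<Longrightarrow> unif_near e (disc_moebius a) (disc_moebius x)"
      using disc_moebius_unif_continuous[OF a e] by blast
    then have "N\<^sup>+\<^sup>+ (disc_moebius a) (disc_moebius x)" if "x \<in> moebius_params \<inter> U" for x
      using that a disc_moebius_in_disc_Aut by (intro tranclp.r_into_trancl) (auto simp: N_def)
    then show "\<exists>T. openin (top_of_set moebius_params) T \<and> a \<in> T \<and>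
        (\<forall>x\<in>T. N\<^sup>+\<^sup>+ (disc_moebius a) (disc_moebius x))"
      using U(1,2) a by (intro exI[of _ "moebius_params \<inter> U"]) (auto simp: openin_open)
  qed
  then show ?thesis
    using p q by (simp add: N_def)
qed

lemma disc_Aut_separable:
  obtains q :: "nat \<Rightarrow> complex \<Rightarrow> complex"
  where "range q \<subseteq> disc_Aut" "\<And>f e. \<lbrakk>f \<in> disc_Aut; e > 0\<rbrakk> \<Longrightarrow> \<exists>k. unif_near e f (q k)"
proof -
  obtain D where D: "countable D" "D \<subseteq> moebius_params" "moebius_params \<subseteq> closure D"
    by (rule separable)
  have "D \<noteq> {}"
    using D(3) by (auto simp: moebius_params_def)
  define q where "q k = disc_moebius (from_nat_into D k)" for k
  show thesis
  proof
    show "range q \<subseteq> disc_Aut"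
      using from_nat_into[OF \<open>D \<noteq> {}\<close>] D(2) disc_moebius_in_disc_Aut unfolding q_def by blast
    fix f and e :: real assume "f \<in> disc_Aut" and e: "e > 0"
    then obtain p where p: "p \<in> moebius_params" "f = disc_moebius p"
      by (auto simp: disc_Aut_eq_moebius)
    obtain U where U: "open U" "p \<in> U"
      "\<And>x. \<lbrakk>x \<in> U; x \<in> moebius_params\<rbrakk> \<Longrightarrow> unif_near e (disc_moebius p) (disc_moebius x)"
      using disc_moebius_unif_continuous[OF p(1) e] by blast
    obtain x where x: "x \<in> D" "x \<in> U"
      using D(3) p(1) U(1,2) by (meson closure_iff_nhds_not_empty disjoint_iff order_refl subsetD)
    obtain k where k: "from_nat_into D k = x"
      using from_nat_into_surj[OF D(1) x(1)] by blast
    have "unif_near e f (q k)"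
      using U(3)[of x] x D(2) by (auto simp: q_def k p(2))
    then show "\<exists>k. unif_near e f (q k)" by blast
  qed
qed

section \<open>From the supremum distance to the compact-open topology\<close>

lemma limitin_disc_AutI:
  assumes "\<forall>\<^sub>F n in F. f n \<in> disc_Aut" "g \<in> disc_Aut"
    and "\<And>e. e > 0 \<Longrightarrow> \<forall>\<^sub>F n in F. unif_near e (f n) g"
  shows "limitin disc_Aut_topology f g F"
  unfolding limitin_disc_Aut_topology_iff[OF assms(1)]
proof (intro conjI allI impI uniform_limitI)
  fix K and e :: real assume "compact K \<and> K \<subseteq> unit_disc" "e > 0"
  then show "\<forall>\<^sub>F n in F. \<forall>x\<in>K. dist (f n x) (g x) < e"
    using assms(3)[of e] by (auto simp: unif_near_def elim!: eventually_mono)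
qed (fact assms)

lemma in_disc_Aut_closureI:
  assumes "A \<subseteq> disc_Aut" "g \<in> disc_Aut" "\<And>e. e > 0 \<Longrightarrow> \<exists>f\<in>A. unif_near e g f"
  shows "g \<in> disc_Aut_topology closure_of A"
proof -
  have "\<forall>n. \<exists>f\<in>A. unif_near (inverse (Suc n)) g f"
    using assms(3) by simp
  then obtain f where f: "\<And>n. f n \<in> A" "\<And>n. unif_near (inverse (Suc n)) g (f n)"
    by metis
  have lim: "limitin disc_Aut_topology f g sequentially"
  proof (rule limitin_disc_AutI)
    show "\<forall>\<^sub>F n in sequentially. f n \<in> disc_Aut"
      using f(1) assms(1) by (simp add: subset_iff)
    fix e :: real assume "e > 0"
    then have "\<forall>\<^sub>F n in sequentially. inverse (real (Suc n)) < e"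
      using order_tendstoD(2)[OF LIMSEQ_inverse_real_of_nat] by simp
    then show "\<forall>\<^sub>F n in sequentially. unif_near e (f n) g"
      by (rule eventually_mono) (use unif_near_mono[OF unif_near_sym[OF f(2)]] in auto)
  qed (fact assms)
  show ?thesis
    using lim by (rule limitin_closedin)
      (use f(1) assms(1) closure_of_subset[of A disc_Aut_topology] in \<open>auto intro!: always_eventually\<close>)
qed

section \<open>A dense left iterated function system with generators tending to the identity\<close>

lemma left_ifs_quotients:
  assumes p: "\<And>n. p n \<in> disc_Aut" and "p 0 = disc_id"
    and \<gamma>: "\<And>n. \<gamma> (Suc n) = compose unit_disc (p (Suc n)) (disc_inv (p n))"
  shows "left_ifs \<gamma> n = p n"
proof (induction n)
  case (Suc n)
  have "compose unit_disc (compose unit_disc (p (Suc n)) (disc_inv (p n))) (p n) z = p (Suc n) z" for z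
    using p[of "Suc n"] disc_inv_f[OF p[of n], of z]
    by (cases "z \<in> unit_disc") (auto simp: compose_def disc_Aut_def extensional_def)
  then show ?case
    by (auto simp: Suc \<gamma>)
qed (simp add: assms)

theorem proposition8p1:
  shows "\<exists>\<gamma> :: nat \<Rightarrow> complex \<Rightarrow> complex.
    (\<forall>n\<ge>1. \<gamma> n \<in> disc_Aut) \<and>
    limitin disc_Aut_topology \<gamma> disc_id sequentially \<and>
    disc_Aut_topology closure_of {left_ifs \<gamma> n | n. n \<ge> 1} = disc_Aut"
proof -
  obtain d :: "nat \<Rightarrow> complex \<Rightarrow> complex" where d: "range d \<subseteq> disc_Aut"
    and dense: "\<And>f e. \<lbrakk>f \<in> disc_Aut; e > 0\<rbrakk> \<Longrightarrow> \<exists>k. unif_near e f (d k)"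
    using disc_Aut_separable by blast
  \<comment> \<open>The walk has to start at the empty composition. The shift by one also makes each \<open>d k\<close> be
    reached at a time \<open>\<ge> 1\<close>.\<close>
  define q where "q = case_nat disc_id d"
  have q: "q k \<in> disc_Aut" for k
    using d disc_id_in_disc_Aut by (auto simp: q_def split: nat.split)
  define R where "R = (\<lambda>k f g. f \<in> disc_Aut \<and> g \<in> disc_Aut \<and> unif_near (inverse (Suc k)) f g)"
  have mono: "R k f g" if "k \<le> l" "R l f g" for k l f g
  proof -
    have "inverse (real (Suc l)) \<le> inverse (real (Suc k))"
      using that(1) by (intro le_imp_inverse_le) auto
    then show ?thesis
      using that(2) unif_near_mono by (auto simp: R_def)
  qed
  have link: "(R k)\<^sup>+\<^sup>+ (q k) (q (Suc k))" for k
    unfolding R_def by (rule disc_Aut_linked[OF q q]) simp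
  obtain p T where T: "strict_mono T" "T 0 = 0" and pT: "\<And>k. p (T k) = q k"
    and step: "\<And>k n. T k \<le> n \<Longrightarrow> R k (p n) (p (Suc n))"
  proof (rule concatenated_walk[of R q])
    show "R k f g" if "k \<le> l" "R l f g" for k l f g
      using that by (rule mono)
  qed (use link in blast)+
  have p: "p n \<in> disc_Aut" for n
    using step[of 0 n] T(2) by (simp add: R_def)
  have p0: "p 0 = disc_id"
    using pT[of 0] T(2) by (simp add: q_def)
  define \<gamma> where "\<gamma> n = compose unit_disc (p n) (disc_inv (p (n - 1)))" for n
  have \<gamma>: "\<gamma> n \<in> disc_Aut" for n
    unfolding \<gamma>_def by (intro disc_Aut_compose disc_inv_in_disc_Aut p)
  have L: "left_ifs \<gamma> n = p n" for n
    using p p0 by (rule left_ifs_quotients) (simp add: \<gamma>_def)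
  have "limitin disc_Aut_topology \<gamma> disc_id sequentially"
  proof (rule limitin_disc_AutI)
    fix e :: real assume "e > 0"
    then obtain k where k: "inverse (real (Suc k)) < e"
      using reals_Archimedean by blast
    have "unif_near e (\<gamma> (Suc n)) disc_id" if "T k \<le> n" for n
    proof -
      have "unif_near e (p (Suc n)) (p n)"
        using step[OF that] k by (auto simp: R_def intro!: unif_near_sym[of _ "p n"] elim: unif_near_mono)
      then have "unif_near e (\<gamma> (Suc n)) (compose unit_disc (p n) (disc_inv (p n)))"
        unfolding \<gamma>_def using unif_near_right_translate disc_inv_in_disc_Aut p by simp
      then show ?thesis
        using f_disc_inv(2)[OF p[of n]] by (simp add: unif_near_def compose_def disc_id_def)
    qed
    then have "\<forall>\<^sub>F n in sequentially. unif_near e (\<gamma> (Suc n)) disc_id"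
      by (rule eventually_sequentiallyI)
    then show "\<forall>\<^sub>F n in sequentially. unif_near e (\<gamma> n) disc_id"
      by (rule eventually_sequentially_Suc[THEN iffD1])
  qed (use \<gamma> disc_id_in_disc_Aut in auto)
  moreover have "disc_Aut_topology closure_of {left_ifs \<gamma> n | n. n \<ge> 1} = disc_Aut"
  proof
    show "disc_Aut_topology closure_of {left_ifs \<gamma> n | n. n \<ge> 1} \<subseteq> disc_Aut"
      using closure_of_subset_topspace[of disc_Aut_topology] by simp
    show "disc_Aut \<subseteq> disc_Aut_topology closure_of {left_ifs \<gamma> n | n. n \<ge> 1}"
    proof (intro subsetI in_disc_Aut_closureI)
      fix f and e :: real assume "f \<in> disc_Aut" "e > 0"
      then obtain k where "unif_near e f (d k)"
        using dense by blast
      moreover have "d k = left_ifs \<gamma> (T (Suc k))"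
        by (simp add: L pT q_def)
      moreover have "T (Suc k) \<ge> 1"
        using strict_mono_less[OF T(1), of 0 "Suc k"] by simp
      ultimately show "\<exists>g\<in>{left_ifs \<gamma> n | n. n \<ge> 1}. unif_near e f g"
        by auto
    qed (auto simp: L p)
  qed
  ultimately show ?thesis
    using \<gamma> by blast
qed

end
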